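(* Let $(X,d)$ be a path-connected metric space, $x_0\in X$, $n\geq 1$. The $\pi_1$-action $\pi_1(X,x_0)\times\pi_n(X,x_0)\to\pi_n(X,x_0)$, $([\gamma],[\alpha])\mapsto[\gamma\ast\alpha]$, is jointly continuous when $\pi_1(X,x_0)$ and $\pi_n(X,x_0)$ carry the topologies induced by their pseudometrics $\rho$. Moreover, $\pi_1(X,x_0)$ acts on $(\pi_n(X,x_0),\rho)$ by isometries.
   Context: For $k\geq1$, identify $k$-loops with based maps $(S^k,d_0)\to(X,x_0)$, $d_0=(1,0,\dots,0)$, with uniform metric $\mu(\alpha,\beta)=\sup_{t}d(\alpha(t),\beta(t))$; on $\pi_k(X,x_0)$ set $\rho(a,b)=\inf\{\mu(\alpha,\beta)\mid\alpha\in a,\beta\in b\}$ (a pseudometric), topologized by its open balls. Path-conjugation: fix a retraction $r:S^n\times[0,1]\to S^n\times\{0\}\cup\{d_0\}\times[0,1]$. For a path $\gamma$ and a based map $\alpha:(S^n,d_0)\to(X,\gamma(1))$, let $h$ be $\alpha$ on $S^n\times\{0\}$ and $h(d_0,s)=\gamma(1-s)$; then $\gamma\ast\alpha:(S^n,d_0)\to(X,\gamma(0))$ is $t\mapsto h(r(t,1))$. For loops $\gamma$ at $x_0$ this induces the usual action of $\pi_1(X,x_0)$ on $\pi_n(X,x_0)$. *)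

theory Defs
  imports "HOL-Analysis.Analysis"
begin

text \<open>k-loops: based maps (S^k, d0) -> (X, x0), where S^k is the unit sphere of a
  Euclidean space of dimension k+1 and X is the whole (metric) type.\<close>
definition based_maps :: "'b::real_normed_vector \<Rightarrow> 'a::topological_space \<Rightarrow> ('b \<Rightarrow> 'a) set" where
  "based_maps d0 x0 = {\<alpha>. continuous_on (sphere 0 1) \<alpha> \<and> \<alpha> d0 = x0}"

definition based_homotopic :: "'b::real_normed_vector \<Rightarrow> 'a::topological_space \<Rightarrow> ('b \<Rightarrow> 'a) \<Rightarrow> ('b \<Rightarrow> 'a) \<Rightarrow> bool" where
  "based_homotopic d0 x0 \<alpha> \<beta> = homotopic_with_canon (\<lambda>f. f d0 = x0) (sphere 0 1) UNIV \<alpha> \<beta>"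

definition hclass :: "'b::real_normed_vector \<Rightarrow> 'a::topological_space \<Rightarrow> ('b \<Rightarrow> 'a) \<Rightarrow> ('b \<Rightarrow> 'a) set" where
  "hclass d0 x0 \<alpha> = {\<beta> \<in> based_maps d0 x0. based_homotopic d0 x0 \<alpha> \<beta>}"

definition homotopy_set :: "'b::real_normed_vector \<Rightarrow> 'a::topological_space \<Rightarrow> ('b \<Rightarrow> 'a) set set" where
  "homotopy_set d0 x0 = hclass d0 x0 ` based_maps d0 x0"

definition unif_dist :: "('b::real_normed_vector \<Rightarrow> 'a::metric_space) \<Rightarrow> ('b \<Rightarrow> 'a) \<Rightarrow> real" where
  "unif_dist \<alpha> \<beta> = (SUP t\<in>sphere 0 1. dist (\<alpha> t) (\<beta> t))"

definition hdist :: "('b::real_normed_vector \<Rightarrow> 'a::metric_space) set \<Rightarrow> ('b \<Rightarrow> 'a) set \<Rightarrow> real" where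
  "hdist a b = Inf {unif_dist \<alpha> \<beta> | \<alpha> \<beta>. \<alpha> \<in> a \<and> \<beta> \<in> b}"

definition htop :: "'b::real_normed_vector \<Rightarrow> 'a::metric_space \<Rightarrow> ('b \<Rightarrow> 'a) set topology" where
  "htop d0 x0 = topology_generated_by
     {{b \<in> homotopy_set d0 x0. hdist a b < e} | a e. a \<in> homotopy_set d0 x0 \<and> e > 0}"

definition path_of_loop :: "(complex \<Rightarrow> 'a) \<Rightarrow> real \<Rightarrow> 'a" where
  "path_of_loop g = (\<lambda>s. g (cis (2 * pi * s)))"

text \<open>Path conjugation gamma * alpha via the retraction r:
  h = alpha on S^n x {0}, h(d0,s) = gamma(1-s); (gamma * alpha)(t) = h (r (t,1)).\<close>
definition path_conj :: "('b \<times> real \<Rightarrow> 'b \<times> real) \<Rightarrow> (real \<Rightarrow> 'a) \<Rightarrow> ('b \<Rightarrow> 'a) \<Rightarrow> 'b \<Rightarrow> 'a" where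
  "path_conj r \<gamma> \<alpha> = (\<lambda>t. case r (t, 1) of (u, s) \<Rightarrow> if s = 0 then \<alpha> u else \<gamma> (1 - s))"

definition pi1_action :: "('b::real_normed_vector \<times> real \<Rightarrow> 'b \<times> real) \<Rightarrow> 'b \<Rightarrow> 'a::topological_space
    \<Rightarrow> (complex \<Rightarrow> 'a) set \<Rightarrow> ('b \<Rightarrow> 'a) set \<Rightarrow> ('b \<Rightarrow> 'a) set" where
  "pi1_action r d0 x0 c a =
     hclass d0 x0 (path_conj r (path_of_loop (SOME g. g \<in> c)) (SOME \<alpha>. \<alpha> \<in> a))"

end

theory Submission
  imports Defs
begin

text \<open>A pair (loop, map) extends to the wedge \<open>S \<times> {0} \<union> {d0} \<times> [0,1]\<close>, and \<open>\<gamma> * \<alpha>\<close> is this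
  extension composed with \<open>t \<mapsto> r (t, 1)\<close>. Hence uniform distances satisfy
  \<open>\<mu>(\<gamma> * \<alpha>, \<gamma>' * \<alpha>') \<le> max (\<mu>(\<gamma>, \<gamma>')) (\<mu>(\<alpha>, \<alpha>'))\<close>. Taking \<open>\<gamma> = \<gamma>'\<close>, every class acts without
  increasing \<open>\<rho>\<close>, and since it has an inverse it acts by an isometry. For continuity at \<open>(c, a)\<close> with
  \<open>\<rho>(a0, c a) < e\<close>, the product of the ball around \<open>c\<close> and the ball around \<open>c\<inverse> a0\<close>, both of
  radius \<open>e\<close>, is mapped into the ball around \<open>a0\<close>; the triangle inequality for \<open>\<rho>\<close> is never used.
  That \<open>c\<inverse>\<close> acts as an inverse follows from the fact that for every map \<open>K\<close> on the
  cylinder, \<open>K(\<cdot>, 1)\<close> and \<open>K \<circ> r(\<cdot>, 1)\<close> are homotopic relative to \<open>d0\<close>.\<close>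

section \<open>Based homotopy classes\<close>

text \<open>With \<open>d0\<close> on the sphere, the condition \<open>f d0 = x0\<close> depends
  only on the values of \<open>f\<close> there, so the ends of a homotopy have to match \<alpha> and
  \<beta> only on the sphere.\<close>

lemma based_homotopic_iff:
  fixes d0 :: "'b::real_normed_vector"
  assumes "d0 \<in> sphere 0 1"
  shows "based_homotopic d0 x0 \<alpha> \<beta> \<longleftrightarrow>
    (\<exists>h. continuous_on ({0..1} \<times> sphere 0 1) h \<and> (\<forall>x\<in>sphere 0 1. h (0, x) = \<alpha> x) \<and>
         (\<forall>x\<in>sphere 0 1. h (1, x) = \<beta> x) \<and> (\<forall>t\<in>{0..1::real}. h (t, d0) = x0))"
  unfolding based_homotopic_def
  by (subst homotopic_with) (use assms in auto)

lemma based_homotopic_refl: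
  "\<alpha> \<in> based_maps d0 x0 \<Longrightarrow> based_homotopic d0 x0 \<alpha> \<alpha>"
  by (simp add: based_homotopic_def based_maps_def)

lemma based_homotopic_sym:
  "based_homotopic d0 x0 \<alpha> \<beta> \<Longrightarrow> based_homotopic d0 x0 \<beta> \<alpha>"
  by (simp add: based_homotopic_def homotopic_with_sym)

lemma based_homotopic_trans:
  "based_homotopic d0 x0 \<alpha> \<beta> \<Longrightarrow> based_homotopic d0 x0 \<beta> \<delta> \<Longrightarrow> based_homotopic d0 x0 \<alpha> \<delta>"
  unfolding based_homotopic_def by (rule homotopic_with_trans)

lemma hclass_eqI:
  "based_homotopic d0 x0 \<alpha> \<beta> \<Longrightarrow> hclass d0 x0 \<alpha> = hclass d0 x0 \<beta>"
  unfolding hclass_def using based_homotopic_sym based_homotopic_trans by blast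

lemma hclass_self: "\<alpha> \<in> based_maps d0 x0 \<Longrightarrow> \<alpha> \<in> hclass d0 x0 \<alpha>"
  by (simp add: hclass_def based_homotopic_refl)

lemma hclass_in_homotopy_set: "\<alpha> \<in> based_maps d0 x0 \<Longrightarrow> hclass d0 x0 \<alpha> \<in> homotopy_set d0 x0"
  by (simp add: homotopy_set_def)

lemma homotopy_set_memberD:
  assumes "a \<in> homotopy_set d0 x0" "\<alpha> \<in> a"
  shows "\<alpha> \<in> based_maps d0 x0" "a = hclass d0 x0 \<alpha>"
  using assms hclass_eqI by (fastforce simp: homotopy_set_def hclass_def)+

lemma homotopy_set_member_homotopic:
  assumes "a \<in> homotopy_set d0 x0" "\<alpha> \<in> a" "\<beta> \<in> a"
  shows "based_homotopic d0 x0 \<alpha> \<beta>"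
  using homotopy_set_memberD(2)[OF assms(1,2)] assms(3) by (simp add: hclass_def)

lemma homotopy_set_nonempty: "a \<in> homotopy_set d0 x0 \<Longrightarrow> \<exists>\<alpha>. \<alpha> \<in> a"
  using hclass_self by (fastforce simp: homotopy_set_def)

section \<open>The pseudometric\<close>

text \<open>Compactness of the sphere bounds the continuous function
  \<open>dist (\<alpha> t) (\<beta> t)\<close>, so the supremum is a true upper bound.\<close>

lemma dist_le_unif_dist:
  fixes \<alpha> \<beta> :: "'b::euclidean_space \<Rightarrow> 'a::metric_space"
  assumes "continuous_on (sphere 0 1) \<alpha>" "continuous_on (sphere 0 1) \<beta>" "t \<in> sphere 0 1"
  shows "dist (\<alpha> t) (\<beta> t) \<le> unif_dist \<alpha> \<beta>"
proof -
  have "compact ((\<lambda>t. dist (\<alpha> t) (\<beta> t)) ` sphere 0 1)"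
    by (intro compact_continuous_image continuous_intros assms compact_sphere)
  then show ?thesis
    unfolding unif_dist_def
    by (intro cSUP_upper assms) (simp add: compact_imp_bounded bounded_imp_bdd_above)
qed

lemma unif_dist_le:
  fixes d0 :: "'b::real_normed_vector" and \<alpha> \<beta> :: "'b \<Rightarrow> 'a::metric_space"
  assumes "d0 \<in> sphere 0 1" "\<And>t. t \<in> sphere 0 1 \<Longrightarrow> dist (\<alpha> t) (\<beta> t) \<le> B"
  shows "unif_dist \<alpha> \<beta> \<le> B"
  unfolding unif_dist_def using assms by (intro cSUP_least) blast+

lemma unif_dist_nonneg:
  fixes d0 :: "'b::euclidean_space" and x0 :: "'a::metric_space"
  assumes "d0 \<in> sphere 0 1" "\<alpha> \<in> based_maps d0 x0" "\<beta> \<in> based_maps d0 x0"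
  shows "0 \<le> unif_dist \<alpha> \<beta>"
proof -
  have "dist (\<alpha> d0) (\<beta> d0) \<le> unif_dist \<alpha> \<beta>"
    using assms by (intro dist_le_unif_dist) (auto simp: based_maps_def)
  then show ?thesis
    by (rule order_trans[OF zero_le_dist])
qed

text \<open>The distances form a nonempty set bounded below by 0. Their infimum need not be
  attained, so later estimates are strict and witnessed by representatives.\<close>

lemma hdist_less_iff:
  fixes d0 :: "'b::euclidean_space" and x0 :: "'a::metric_space"
  assumes d0: "d0 \<in> sphere 0 1" and a: "a \<in> homotopy_set d0 x0" and b: "b \<in> homotopy_set d0 x0"
  shows "hdist a b < e \<longleftrightarrow> (\<exists>\<alpha>\<in>a. \<exists>\<beta>\<in>b. unif_dist \<alpha> \<beta> < e)"
proof -
  let ?D = "{unif_dist \<alpha> \<beta> | \<alpha> \<beta>. \<alpha> \<in> a \<and> \<beta> \<in> b}"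
  have "0 \<le> unif_dist \<alpha> \<beta>" if "\<alpha> \<in> a" "\<beta> \<in> b" for \<alpha> \<beta>
    using unif_dist_nonneg[OF d0 homotopy_set_memberD(1)[OF a that(1)]
        homotopy_set_memberD(1)[OF b that(2)]] .
  then have "bdd_below ?D"
    by (intro bdd_belowI[of _ 0]) blast
  moreover have "?D \<noteq> {}"
    using homotopy_set_nonempty[OF a] homotopy_set_nonempty[OF b] by blast
  ultimately have "hdist a b < e \<longleftrightarrow> (\<exists>x\<in>?D. x < e)"
    unfolding hdist_def by (intro cInf_less_iff)
  also have "\<dots> \<longleftrightarrow> (\<exists>\<alpha>\<in>a. \<exists>\<beta>\<in>b. unif_dist \<alpha> \<beta> < e)"
    by blast
  finally show ?thesis .
qed

lemma hdist_nonneg: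
  fixes d0 :: "'b::euclidean_space" and x0 :: "'a::metric_space"
  assumes d0: "d0 \<in> sphere 0 1" and a: "a \<in> homotopy_set d0 x0" and b: "b \<in> homotopy_set d0 x0"
  shows "0 \<le> hdist a b"
proof (rule ccontr)
  assume "\<not> 0 \<le> hdist a b"
  then obtain \<alpha> \<beta> where \<alpha>\<beta>: "\<alpha> \<in> a" "\<beta> \<in> b" and less: "unif_dist \<alpha> \<beta> < 0"
    unfolding not_le hdist_less_iff[OF assms] by blast
  show False
    using unif_dist_nonneg[OF d0 homotopy_set_memberD(1)[OF a \<alpha>\<beta>(1)]
        homotopy_set_memberD(1)[OF b \<alpha>\<beta>(2)]] less
    by simp
qed

lemma hdist_self_less:
  fixes d0 :: "'b::euclidean_space" and x0 :: "'a::metric_space"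
  assumes "d0 \<in> sphere 0 1" "a \<in> homotopy_set d0 x0" "e > 0"
  shows "hdist a a < e"
proof -
  obtain \<alpha> where "\<alpha> \<in> a"
    using homotopy_set_nonempty[OF assms(2)] by blast
  moreover have "unif_dist \<alpha> \<alpha> \<le> 0"
    using assms(1) by (rule unif_dist_le) simp
  ultimately show ?thesis
    using hdist_less_iff[OF assms(1,2,2)] assms(3) by (meson order_le_less_trans)
qed

section \<open>The topology generated by balls\<close>

lemma topspace_htop:
  fixes d0 :: "'b::euclidean_space" and x0 :: "'a::metric_space"
  assumes "d0 \<in> sphere 0 1"
  shows "topspace (htop d0 x0) = homotopy_set d0 x0"
  unfolding htop_def topology_generated_by_topspace
proof (intro equalityI subsetI)
  fix a assume a: "a \<in> homotopy_set d0 x0"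
  then have "a \<in> {b \<in> homotopy_set d0 x0. hdist a b < 1}"
    using hdist_self_less[OF assms a, of 1] by simp
  then show "a \<in> \<Union>{{b \<in> homotopy_set d0 x0. hdist a b < e} | a e. a \<in> homotopy_set d0 x0 \<and> e > 0}"
    using a zero_less_one by blast
qed blast

lemma openin_htop_ball:
  "a \<in> homotopy_set d0 x0 \<Longrightarrow> e > 0 \<Longrightarrow> openin (htop d0 x0) {b \<in> homotopy_set d0 x0. hdist a b < e}"
  unfolding htop_def by (rule topology_generated_by_Basis) auto

section \<open>Path conjugation\<close>

lemma continuous_on_path_of_loop:
  "continuous_on (sphere 0 1) g \<Longrightarrow> continuous_on {0..1} (path_of_loop g)"
  unfolding path_of_loop_def
  by (rule continuous_on_compose2[of "sphere 0 1" g]) (auto intro!: continuous_intros)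

lemma path_of_loop_endpoints: "path_of_loop g 0 = g 1" "path_of_loop g 1 = g 1"
  by (simp_all add: path_of_loop_def)

text \<open>Complex conjugation runs the circle backwards, so \<open>g \<circ> cnj\<close> is the
  reversed loop and will represent the inverse of the class of \<open>g\<close>.\<close>

lemma path_of_loop_cnj: "path_of_loop (g \<circ> cnj) s = path_of_loop g (1 - s)"
proof -
  have "cis (2 * pi * (1 - s)) = cis (2 * pi) * cis (- (2 * pi * s))"
    by (simp only: cis_mult) (simp add: algebra_simps)
  then show ?thesis
    by (simp add: path_of_loop_def cis_cnj)
qed

lemma based_maps_cnj:
  assumes "g \<in> based_maps 1 x0"
  shows "g \<circ> cnj \<in> based_maps (1::complex) x0"
proof -
  have "continuous_on (sphere 0 1) (\<lambda>z. g (cnj z))"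
    by (rule continuous_on_compose2[of "sphere 0 1" g])
      (use assms in \<open>auto simp: based_maps_def intro!: continuous_on_cnj continuous_on_id\<close>)
  then show ?thesis
    using assms by (simp add: based_maps_def o_def)
qed

text \<open>Pasting along two closed pieces, which can meet only in points
  \<open>(v, d0, 0)\<close>, where \<open>eq\<close> makes the branches agree. The parameter
  \<open>v\<close> lets the lemma cover homotopies as well as single maps.\<close>

lemma continuous_on_wedge:
  fixes A :: "real \<times> 'b::euclidean_space \<Rightarrow> 'a::topological_space"
  assumes A: "continuous_on ({0..1} \<times> sphere 0 1) A"
    and G: "continuous_on ({0..1} \<times> {0..1}) G"
    and eq: "\<And>v. v \<in> {0..1} \<Longrightarrow> A (v, d0) = G (v, 1)"
  shows "continuous_on ({0..1} \<times> (sphere 0 1 \<times> {0} \<union> {d0} \<times> {0..1}))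
           (\<lambda>(v, u, s). if s = 0 then A (v, u) else G (v, 1 - s :: real))"
proof -
  have "continuous_on ({0..1} \<times> (sphere 0 1 \<times> {0}) \<union> {0..1} \<times> ({d0} \<times> {0..1}))
          (\<lambda>x. if snd (snd x) = 0 then A (fst x, fst (snd x)) else G (fst x, 1 - snd (snd x)))"
  proof (rule continuous_on_cases)
    show "continuous_on ({0..1} \<times> (sphere 0 1 \<times> {0::real})) (\<lambda>x. A (fst x, fst (snd x)))"
      by (rule continuous_on_compose2[OF A]) (auto intro!: continuous_intros)
    show "continuous_on ({0..1} \<times> ({d0} \<times> {0..1})) (\<lambda>x. G (fst x, 1 - snd (snd x)))"
      by (rule continuous_on_compose2[OF G]) (auto intro!: continuous_intros)
  qed (auto intro!: closed_Times simp: eq)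
  then show ?thesis
    by (simp add: case_prod_unfold Sigma_Un_distrib2)
qed

section \<open>The cylinder and its retraction onto the wedge\<close>

locale cylinder_retraction =
  fixes d0 :: "'b::euclidean_space" and r :: "'b \<times> real \<Rightarrow> 'b \<times> real"
  assumes base: "d0 \<in> sphere 0 1"
    and retr: "retraction (sphere 0 1 \<times> {0..1}) (sphere 0 1 \<times> {0} \<union> {d0} \<times> {0..1}) r"
begin

lemma continuous_on_r: "continuous_on (sphere 0 1 \<times> {0..1}) r"
  using retr by (simp add: retraction_def)

lemma r_range:
  "t \<in> sphere 0 1 \<Longrightarrow> s \<in> {0..1} \<Longrightarrow> r (t, s) \<in> sphere 0 1 \<times> {0} \<union> {d0} \<times> {0..1}"
  using retr unfolding retraction_def by blast

lemma r_bottom: "t \<in> sphere 0 1 \<Longrightarrow> r (t, 0) = (t, 0)"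
  using retr by (auto simp: retraction_def)

lemma r_base: "s \<in> {0..1} \<Longrightarrow> r (d0, s) = (d0, s)"
  using retr by (auto simp: retraction_def)

lemma cylinder_top_homotopic:
  assumes K: "continuous_on (sphere 0 1 \<times> {0..1}) K" and K1: "K (d0, 1) = x0"
  shows "based_homotopic d0 x0 (\<lambda>t. K (t, 1)) (\<lambda>t. K (r (t, 1)))"
proof -
  \<comment> \<open>At time \<open>v\<close>, \<open>K\<close> restricted to heights \<open>\<ge> 1 - v\<close> is replaced by its values on the wedge
    of a cylinder of height \<open>v\<close>.\<close>
  define h where "h = (\<lambda>x. K (fst (r (snd x, fst x)), min 1 (1 - fst x + snd (r (snd x, fst x)))))"
  have cr: "continuous_on ({0..1} \<times> sphere 0 1) (\<lambda>x. r (snd x, fst x))"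
    by (rule continuous_on_compose2[OF continuous_on_r]) (auto intro!: continuous_intros)
  have in_cyl: "r (t, v) \<in> sphere 0 1 \<times> {0..1}" if "t \<in> sphere 0 1" "v \<in> {0..1}" for t v
    using r_range[OF that] base by auto
  \<comment> \<open>The retraction may send \<open>(t, v)\<close> to a height above
    \<open>v\<close>, and \<open>1 - v\<close> plus that height may then exceed 1;
    \<open>min 1\<close> keeps the argument of \<open>K\<close> in the cylinder.\<close>
  have "continuous_on ({0..1} \<times> sphere 0 1) h"
    unfolding h_def
  proof (rule continuous_on_compose2[OF K])
    show "(\<lambda>x. (fst (r (snd x, fst x)), min 1 (1 - fst x + snd (r (snd x, fst x)))))
            ` ({0..1} \<times> sphere 0 1) \<subseteq> sphere 0 1 \<times> {0..1}"
      using in_cyl by (force simp: mem_Times_iff)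
  qed (intro continuous_intros cr)
  moreover have "h (1, t) = K (r (t, 1))" if "t \<in> sphere 0 1" for t
    using in_cyl[OF that, of 1] by (simp add: h_def mem_Times_iff)
  \<comment> \<open>Time 0 gives \<open>K (t, 1)\<close> by \<open>r_bottom\<close>. At
    \<open>d0\<close>, \<open>r_base\<close> gives the height \<open>1 - v + v = 1\<close>, so the
    base point stays at \<open>K (d0, 1) = x0\<close>.\<close>
  ultimately show ?thesis
    unfolding based_homotopic_iff[OF base]
    by (intro exI[of _ h]) (auto simp: h_def r_bottom r_base K1)
qed

text \<open>The wedge map given by \<alpha> and \<gamma> extends to the cylinder by precomposition
  with \<open>r\<close>. On the sphere, the bottom of the extension is \<alpha> and its top is
  \<open>path_conj r \<gamma> \<alpha>\<close>.\<close>

lemma continuous_on_cylinder_extension: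
  assumes \<alpha>: "continuous_on (sphere 0 1) \<alpha>" and \<gamma>: "continuous_on {0..1} \<gamma>" and eq: "\<alpha> d0 = \<gamma> 1"
  shows "continuous_on (sphere 0 1 \<times> {0..1})
           (\<lambda>x. case r x of (u, s) \<Rightarrow> if s = 0 then \<alpha> u else \<gamma> (1 - s))"
proof -
  have "continuous_on ({0..1::real} \<times> sphere 0 1) (\<alpha> \<circ> snd)"
    unfolding o_def by (rule continuous_on_compose2[OF \<alpha>]) (auto intro: continuous_on_snd)
  moreover have "continuous_on ({0..1::real} \<times> {0..1}) (\<gamma> \<circ> snd)"
    unfolding o_def by (rule continuous_on_compose2[OF \<gamma>]) (auto intro: continuous_on_snd)
  ultimately have "continuous_on ({0..1} \<times> (sphere 0 1 \<times> {0} \<union> {d0} \<times> {0..1}))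
          (\<lambda>(v::real, u, s). if s = 0 then (\<alpha> \<circ> snd) (v, u) else (\<gamma> \<circ> snd) (v, 1 - s))"
    by (rule continuous_on_wedge) (simp add: eq)
  moreover have "continuous_on (sphere 0 1 \<times> {0..1}) (\<lambda>x. (0::real, r x))"
    by (intro continuous_intros continuous_on_r)
  moreover have "(\<lambda>x. (0::real, r x)) ` (sphere 0 1 \<times> {0..1})
      \<subseteq> {0..1} \<times> (sphere 0 1 \<times> {0} \<union> {d0} \<times> {0..1})"
    using r_range by (simp add: image_subset_iff)
  ultimately have "continuous_on (sphere 0 1 \<times> {0..1})
      (\<lambda>x. (\<lambda>(v::real, u, s). if s = 0 then (\<alpha> \<circ> snd) (v, u) else (\<gamma> \<circ> snd) (v, 1 - s)) (0, r x))"
    by (rule continuous_on_compose2)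
  then show ?thesis
    by (simp add: case_prod_unfold cong: if_cong)
qed

section \<open>Conjugation of based maps and its effect on homotopies\<close>

lemma path_conj_in_based_maps:
  assumes "\<alpha> \<in> based_maps d0 x0" "g \<in> based_maps 1 x0"
  shows "path_conj r (path_of_loop g) \<alpha> \<in> based_maps d0 x0"
proof -
  have "continuous_on (sphere 0 1 \<times> {0..1})
          (\<lambda>x. case r x of (u, s) \<Rightarrow> if s = 0 then \<alpha> u else path_of_loop g (1 - s))"
    using assms
    by (intro continuous_on_cylinder_extension continuous_on_path_of_loop)
      (auto simp: based_maps_def path_of_loop_endpoints)
  then have "continuous_on (sphere 0 1) (path_conj r (path_of_loop g) \<alpha>)"
    unfolding path_conj_def
    by (rule continuous_on_compose2[where f = "\<lambda>t. (t, 1)"]) (auto intro!: continuous_intros)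
  then show ?thesis
    using assms by (simp add: based_maps_def path_conj_def r_base path_of_loop_endpoints)
qed

text \<open>Both homotopies stay at \<open>x0\<close> over the wedge point, so they glue to a
  homotopy on the wedge, which is pulled back along \<open>r (t, 1)\<close>. This makes the action
  independent of representatives.\<close>

lemma path_conj_homotopic:
  assumes "based_homotopic d0 x0 \<alpha> \<alpha>'" "based_homotopic 1 x0 g g'"
  shows "based_homotopic d0 x0 (path_conj r (path_of_loop g) \<alpha>) (path_conj r (path_of_loop g') \<alpha>')"
proof -
  obtain A where A: "continuous_on ({0..1} \<times> sphere 0 1) A"
      "\<forall>x\<in>sphere 0 1. A (0, x) = \<alpha> x" "\<forall>x\<in>sphere 0 1. A (1, x) = \<alpha>' x"
      "\<forall>t\<in>{0..1::real}. A (t, d0) = x0"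
    using assms(1) unfolding based_homotopic_iff[OF base] by blast
  have ends: "\<alpha> d0 = x0" "\<alpha>' d0 = x0"
    using bspec[OF A(2) base] bspec[OF A(3) base] A(4) by simp_all
  have one: "(1::complex) \<in> sphere 0 1"
    by simp
  obtain G where G: "continuous_on ({0..1} \<times> sphere 0 1) G"
      "\<forall>x\<in>sphere 0 1. G (0, x) = g x" "\<forall>x\<in>sphere 0 1. G (1, x) = g' x"
      "\<forall>t\<in>{0..1::real}. G (t, 1) = x0"
    using assms(2) unfolding based_homotopic_iff[OF one] by blast
  \<comment> \<open>\<open>P\<close> is the loop homotopy in path coordinates. Since
    \<open>cis (2 * pi) = 1\<close>, it satisfies \<open>P (v, 1) = G (v, 1) = x0\<close>, as gluing
    with \<open>A\<close> requires.\<close>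
  define P where "P = (\<lambda>(v::real, s). G (v, cis (2 * pi * s)))"
  have "continuous_on ({0..1} \<times> {0..1}) P"
    unfolding P_def case_prod_unfold
    by (rule continuous_on_compose2[OF G(1)]) (auto intro!: continuous_intros)
  then have W: "continuous_on ({0..1} \<times> (sphere 0 1 \<times> {0} \<union> {d0} \<times> {0..1}))
           (\<lambda>(v, u, s). if s = 0 then A (v, u) else P (v, 1 - s))"
    using A G by (intro continuous_on_wedge) (auto simp: P_def)
  define h where "h = (\<lambda>x. (\<lambda>(v, u, s). if s = 0 then A (v, u) else P (v, 1 - s)) (fst x, r (snd x, 1)))"
  have cr: "continuous_on ({0..1::real} \<times> sphere 0 1) (\<lambda>x. r (snd x, 1))"
    by (rule continuous_on_compose2[OF continuous_on_r]) (auto intro!: continuous_intros)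
  have "continuous_on ({0..1::real} \<times> sphere 0 1) (\<lambda>x. (fst x, r (snd x, 1)))"
    by (intro continuous_intros cr)
  moreover have "(\<lambda>x. (fst x, r (snd x, 1))) ` ({0..1::real} \<times> sphere 0 1)
      \<subseteq> {0..1} \<times> (sphere 0 1 \<times> {0} \<union> {d0} \<times> {0..1})"
    using r_range[where s = 1] by (simp add: image_subset_iff)
  ultimately have "continuous_on ({0..1} \<times> sphere 0 1) h"
    unfolding h_def by (rule continuous_on_compose2[OF W])
  moreover have "h (0, t) = path_conj r (path_of_loop g) \<alpha> t"
      "h (1, t) = path_conj r (path_of_loop g') \<alpha>' t" if "t \<in> sphere 0 1" for t
    using r_range[OF that, of 1] A G ends
    by (auto simp: h_def path_conj_def path_of_loop_def P_def)
  moreover have "h (v, d0) = x0" if "v \<in> {0..1}" for v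
    using that G by (simp add: h_def r_base P_def)
  ultimately show ?thesis
    unfolding based_homotopic_iff[OF base] by (intro exI[of _ h]) simp
qed

text \<open>Extend \<alpha> and the reversed loop to a map \<open>L\<close> on the cylinder and turn
  \<open>L\<close> upside down. The top is now \<alpha>, the bottom is the inner conjugate, and the
  line over \<open>d0\<close> carries \<open>g\<close> as conjugation by \<open>g\<close> demands.
  Hence \<open>cylinder_top_homotopic\<close> compares \<alpha> with the double conjugate.\<close>

lemma path_conj_inverse:
  assumes \<alpha>: "\<alpha> \<in> based_maps d0 x0" and g: "g \<in> based_maps 1 x0"
  shows "based_homotopic d0 x0 \<alpha> (path_conj r (path_of_loop g) (path_conj r (path_of_loop (g \<circ> cnj)) \<alpha>))"
proof -
  define L where
    "L = (\<lambda>x. case r x of (u, s) \<Rightarrow> if s = 0 then \<alpha> u else path_of_loop (g \<circ> cnj) (1 - s))"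
  have "continuous_on (sphere 0 1 \<times> {0..1}) L"
    unfolding L_def
    using \<alpha> based_maps_cnj[OF g]
    by (intro continuous_on_cylinder_extension continuous_on_path_of_loop)
      (auto simp: based_maps_def path_of_loop_endpoints)
  then have "continuous_on (sphere 0 1 \<times> {0..1}) (\<lambda>x. L (fst x, 1 - snd x))"
    by (rule continuous_on_compose2) (auto intro!: continuous_intros)
  moreover have "L (d0, 0) = x0"
    using \<alpha> by (simp add: L_def r_base based_maps_def)
  ultimately have "based_homotopic d0 x0 (\<lambda>t. L (t, 0)) (\<lambda>t. L (fst (r (t, 1)), 1 - snd (r (t, 1))))"
    using cylinder_top_homotopic[of "\<lambda>x. L (fst x, 1 - snd x)"] by simp
  then obtain h where h: "continuous_on ({0..1} \<times> sphere 0 1) h"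
      "\<forall>t\<in>sphere 0 1. h (0, t) = L (t, 0)"
      "\<forall>t\<in>sphere 0 1. h (1, t) = L (fst (r (t, 1)), 1 - snd (r (t, 1)))"
      "\<forall>v\<in>{0..1::real}. h (v, d0) = x0"
    unfolding based_homotopic_iff[OF base] by blast
  have bottom: "L (t, 0) = \<alpha> t" if "t \<in> sphere 0 1" for t
    using that by (simp add: L_def r_bottom)
  have top: "L (fst (r (t, 1)), 1 - snd (r (t, 1))) =
      path_conj r (path_of_loop g) (path_conj r (path_of_loop (g \<circ> cnj)) \<alpha>) t" if "t \<in> sphere 0 1" for t
  proof -
    obtain u s where us: "r (t, 1) = (u, s)"
      by (cases "r (t, 1)")
    show ?thesis
    proof (cases "s = 0")
      case True
      then show ?thesis
        by (simp add: us path_conj_def L_def)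
    next
      case False
      \<comment> \<open>Two reversals, \<open>1 - s\<close> and \<open>cnj\<close>, cancel on the
        line over \<open>d0\<close>. At \<open>s = 1\<close>, \<open>L\<close> takes its value from
        \<alpha> instead, and both sides equal \<open>x0\<close>.\<close>
      then have "u = d0" "s \<in> {0..1}"
        using r_range[OF that, of 1] us by auto
      then show ?thesis
        using False \<alpha> g
        by (auto simp: us path_conj_def L_def r_base path_of_loop_cnj path_of_loop_endpoints
            based_maps_def)
    qed
  qed
  show ?thesis
    unfolding based_homotopic_iff[OF base] using h bottom top by (intro exI[of _ h]) simp
qed

text \<open>The point \<open>r (t, 1)\<close> does not depend on the maps, so at each
  \<open>t\<close> either \<alpha> and \<alpha>' are compared at a common point, or \<open>g\<close>
  and \<open>g'\<close> are.\<close>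

lemma unif_dist_path_conj_less:
  fixes x0 :: "'a::metric_space"
  assumes "\<alpha> \<in> based_maps d0 x0" "\<alpha>' \<in> based_maps d0 x0" "g \<in> based_maps 1 x0" "g' \<in> based_maps 1 x0"
    and "unif_dist \<alpha> \<alpha>' < e" "unif_dist g g' < e"
  shows "unif_dist (path_conj r (path_of_loop g) \<alpha>) (path_conj r (path_of_loop g') \<alpha>') < e"
proof -
  have "dist (path_conj r (path_of_loop g) \<alpha> t) (path_conj r (path_of_loop g') \<alpha>' t)
      \<le> max (unif_dist \<alpha> \<alpha>') (unif_dist g g')" if t: "t \<in> sphere 0 1" for t
  proof -
    obtain u s where us: "r (t, 1) = (u, s)"
      by (cases "r (t, 1)")
    have "u \<in> sphere 0 1"
      using r_range[OF t, of 1] us base by auto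
    then have "dist (\<alpha> u) (\<alpha>' u) \<le> unif_dist \<alpha> \<alpha>'"
      using assms by (intro dist_le_unif_dist) (auto simp: based_maps_def)
    moreover have "dist (g (cis x)) (g' (cis x)) \<le> unif_dist g g'" for x
      using assms by (intro dist_le_unif_dist) (auto simp: based_maps_def)
    ultimately show ?thesis
      by (simp add: path_conj_def us path_of_loop_def le_max_iff_disj)
  qed
  then have "unif_dist (path_conj r (path_of_loop g) \<alpha>) (path_conj r (path_of_loop g') \<alpha>')
      \<le> max (unif_dist \<alpha> \<alpha>') (unif_dist g g')"
    by (rule unif_dist_le[OF base])
  then show ?thesis
    using assms by simp
qed

section \<open>The action\<close>

text \<open>The choices by \<open>SOME\<close> in the definition are harmless: any two
  representatives are homotopic, and conjugation respects homotopy.\<close>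

lemma pi1_action_eq:
  assumes c: "c \<in> homotopy_set 1 x0" "g \<in> c" and a: "a \<in> homotopy_set d0 x0" "\<alpha> \<in> a"
  shows "pi1_action r d0 x0 c a = hclass d0 x0 (path_conj r (path_of_loop g) \<alpha>)"
proof -
  have "(SOME g. g \<in> c) \<in> c"
    using c(2) by (auto simp: some_in_eq)
  then have g: "based_homotopic 1 x0 (SOME g. g \<in> c) g"
    using homotopy_set_member_homotopic c by metis
  have "(SOME \<alpha>. \<alpha> \<in> a) \<in> a"
    using a(2) by (auto simp: some_in_eq)
  then have "based_homotopic d0 x0 (SOME \<alpha>. \<alpha> \<in> a) \<alpha>"
    using homotopy_set_member_homotopic a by metis
  from hclass_eqI[OF path_conj_homotopic[OF this g]] show ?thesis
    by (simp only: pi1_action_def)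
qed

lemma path_conj_in_pi1_action:
  assumes "c \<in> homotopy_set 1 x0" "g \<in> c" "a \<in> homotopy_set d0 x0" "\<alpha> \<in> a"
  shows "path_conj r (path_of_loop g) \<alpha> \<in> pi1_action r d0 x0 c a"
  unfolding pi1_action_eq[OF assms]
  by (rule hclass_self[OF path_conj_in_based_maps])
    (rule homotopy_set_memberD(1)[OF assms(3,4)] homotopy_set_memberD(1)[OF assms(1,2)])+

lemma pi1_action_in_homotopy_set:
  assumes "c \<in> homotopy_set 1 x0" "a \<in> homotopy_set d0 x0"
  shows "pi1_action r d0 x0 c a \<in> homotopy_set d0 x0"
proof -
  obtain g \<alpha> where *: "g \<in> c" "\<alpha> \<in> a"
    using homotopy_set_nonempty[OF assms(1)] homotopy_set_nonempty[OF assms(2)] by blast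
  show ?thesis
    unfolding pi1_action_eq[OF assms(1) *(1) assms(2) *(2)]
    by (rule hclass_in_homotopy_set[OF path_conj_in_based_maps])
      (rule homotopy_set_memberD(1)[OF assms(2) *(2)] homotopy_set_memberD(1)[OF assms(1) *(1)])+
qed

text \<open>Representatives at distance below \<open>e\<close> have conjugates at distance below
  \<open>e\<close>. Varying both arguments serves continuity; the case \<open>c = c'\<close> serves
  the isometry claim.\<close>

lemma hdist_pi1_action_less:
  fixes x0 :: "'a::metric_space"
  assumes c: "c \<in> homotopy_set 1 x0" "c' \<in> homotopy_set 1 x0"
    and a: "a \<in> homotopy_set d0 x0" "a' \<in> homotopy_set d0 x0"
    and "hdist c c' < e" "hdist a a' < e"
  shows "hdist (pi1_action r d0 x0 c a) (pi1_action r d0 x0 c' a') < e"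
proof -
  have one: "(1::complex) \<in> sphere 0 1"
    by simp
  obtain g g' where g: "g \<in> c" "g' \<in> c'" "unif_dist g g' < e"
    using iffD1[OF hdist_less_iff[OF one c] assms(5)] by blast
  obtain \<alpha> \<alpha>' where \<alpha>: "\<alpha> \<in> a" "\<alpha>' \<in> a'" "unif_dist \<alpha> \<alpha>' < e"
    using iffD1[OF hdist_less_iff[OF base a] assms(6)] by blast
  note based = homotopy_set_memberD(1)[OF a(1) \<alpha>(1)] homotopy_set_memberD(1)[OF a(2) \<alpha>(2)]
    homotopy_set_memberD(1)[OF c(1) g(1)] homotopy_set_memberD(1)[OF c(2) g(2)]
  show ?thesis
    unfolding hdist_less_iff[OF base pi1_action_in_homotopy_set[OF c(1) a(1)]
        pi1_action_in_homotopy_set[OF c(2) a(2)]]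
    by (intro bexI, rule unif_dist_path_conj_less[OF based \<alpha>(3) g(3)])
      (rule path_conj_in_pi1_action c a g \<alpha>)+
qed

lemma pi1_action_inverse:
  assumes c: "c \<in> homotopy_set (1::complex) x0"
  shows "\<exists>c'\<in>homotopy_set 1 x0. \<forall>a\<in>homotopy_set d0 x0.
    pi1_action r d0 x0 c (pi1_action r d0 x0 c' a) = a \<and>
    pi1_action r d0 x0 c' (pi1_action r d0 x0 c a) = a"
proof -
  obtain g where g: "g \<in> c"
    using homotopy_set_nonempty[OF c] by blast
  have gb: "g \<in> based_maps 1 x0"
    using homotopy_set_memberD(1)[OF c g] .
  let ?g' = "g \<circ> cnj"
  let ?c' = "hclass 1 x0 ?g'"
  have c': "?c' \<in> homotopy_set 1 x0" "?g' \<in> ?c'"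
    using based_maps_cnj[OF gb] by (auto intro: hclass_in_homotopy_set hclass_self)
  \<comment> \<open>Stated for a general pair so that it applies in both orders: as
    \<open>cnj\<close> is an involution, reversing \<open>?g'\<close> gives back
    \<open>g\<close>.\<close>
  have cancel: "pi1_action r d0 x0 k (pi1_action r d0 x0 k' a) = a"
    if "k \<in> homotopy_set 1 x0" "k' \<in> homotopy_set 1 x0" "p \<in> k" "p \<circ> cnj \<in> k'"
      and a: "a \<in> homotopy_set d0 x0" for k k' a and p :: "complex \<Rightarrow> 'a"
  proof -
    obtain \<alpha> where \<alpha>: "\<alpha> \<in> a"
      using homotopy_set_nonempty[OF a] by blast
    have "pi1_action r d0 x0 k (pi1_action r d0 x0 k' a) =
        hclass d0 x0 (path_conj r (path_of_loop p) (path_conj r (path_of_loop (p \<circ> cnj)) \<alpha>))"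
      using that \<alpha> by (intro pi1_action_eq path_conj_in_pi1_action pi1_action_in_homotopy_set)
    also have "\<dots> = hclass d0 x0 \<alpha>"
      by (rule hclass_eqI[OF path_conj_inverse, symmetric])
        (rule homotopy_set_memberD(1)[OF a \<alpha>] homotopy_set_memberD(1)[OF that(1,3)])+
    also have "\<dots> = a"
      using homotopy_set_memberD(2)[OF a \<alpha>] by simp
    finally show ?thesis .
  qed
  have "?g' \<circ> cnj \<in> c"
    using g by (simp add: comp_def)
  then show ?thesis
    using cancel[OF c c'(1) g c'(2)] cancel[OF c'(1) c c'(2)] c'(1) by (intro bexI[of _ ?c']) simp_all
qed

section \<open>Invariance of the pseudometric under the action\<close>

lemma hdist_pi1_action_le:
  fixes x0 :: "'a::metric_space"
  assumes "c \<in> homotopy_set 1 x0" "a \<in> homotopy_set d0 x0" "b \<in> homotopy_set d0 x0"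
  shows "hdist (pi1_action r d0 x0 c a) (pi1_action r d0 x0 c b) \<le> hdist a b"
proof (rule dense_ge)
  fix e assume e: "hdist a b < e"
  have one: "(1::complex) \<in> sphere 0 1"
    by simp
  \<comment> \<open>Here \<open>e\<close> is positive because it exceeds the nonnegative
    \<open>hdist a b\<close>.\<close>
  have "hdist c c < e"
    by (rule hdist_self_less[OF one assms(1) order_le_less_trans[OF hdist_nonneg[OF base assms(2,3)] e]])
  then show "hdist (pi1_action r d0 x0 c a) (pi1_action r d0 x0 c b) \<le> e"
    by (rule less_imp_le[OF hdist_pi1_action_less[OF assms(1,1,2,3) _ e]])
qed

lemma hdist_pi1_action:
  fixes x0 :: "'a::metric_space"
  assumes c: "c \<in> homotopy_set 1 x0" and ab: "a \<in> homotopy_set d0 x0" "b \<in> homotopy_set d0 x0"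
  shows "hdist (pi1_action r d0 x0 c a) (pi1_action r d0 x0 c b) = hdist a b"
proof (rule antisym)
  obtain c' where c': "c' \<in> homotopy_set 1 x0"
    and inv: "\<forall>a\<in>homotopy_set d0 x0. pi1_action r d0 x0 c (pi1_action r d0 x0 c' a) = a \<and>
      pi1_action r d0 x0 c' (pi1_action r d0 x0 c a) = a"
    using pi1_action_inverse[OF c] by (elim bexE)
  show "hdist a b \<le> hdist (pi1_action r d0 x0 c a) (pi1_action r d0 x0 c b)"
    using hdist_pi1_action_le[OF c' pi1_action_in_homotopy_set[OF c ab(1)]
        pi1_action_in_homotopy_set[OF c ab(2)]]
    by (simp add: inv ab)
qed (rule hdist_pi1_action_le[OF assms])

section \<open>Joint continuity\<close>

lemma continuous_map_pi1_action:
  fixes x0 :: "'a::metric_space"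
  shows "continuous_map (prod_topology (htop (1::complex) x0) (htop d0 x0)) (htop d0 x0)
           (\<lambda>(c, a). pi1_action r d0 x0 c a)"
proof -
  let ?T = "prod_topology (htop (1::complex) x0) (htop d0 x0)"
  let ?f = "\<lambda>(c, a). pi1_action r d0 x0 c a"
  have one: "(1::complex) \<in> sphere 0 1"
    by simp
  have top: "topspace ?T = homotopy_set 1 x0 \<times> homotopy_set d0 x0"
    by (simp add: topspace_htop[OF one] topspace_htop[OF base])
  \<comment> \<open>Preimages of the generating balls suffice. Their centre \<open>a0\<close> is
    arbitrary, not the image of the point under consideration.\<close>
  have "openin ?T (?f -` {b \<in> homotopy_set d0 x0. hdist a0 b < e} \<inter> topspace ?T)"
    if a0: "a0 \<in> homotopy_set d0 x0" and "e > 0" for a0 e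
  proof (subst openin_subopen, safe)
    fix c a
    assume "(c, a) \<in> topspace ?T" and less: "hdist a0 (pi1_action r d0 x0 c a) < e"
    then have c: "c \<in> homotopy_set 1 x0" and a: "a \<in> homotopy_set d0 x0"
      using top by auto
    obtain c' where c': "c' \<in> homotopy_set 1 x0"
      and inv: "\<forall>a\<in>homotopy_set d0 x0. pi1_action r d0 x0 c (pi1_action r d0 x0 c' a) = a \<and>
        pi1_action r d0 x0 c' (pi1_action r d0 x0 c a) = a"
      using pi1_action_inverse[OF c] by (elim bexE)
    \<comment> \<open>Pulling the centre back by the inverse class gives \<open>c\<close> acting on
      \<open>?a1\<close> equal to \<open>a0\<close>, and the isometry property keeps
      \<open>a\<close> within \<open>e\<close> of \<open>?a1\<close>, with no loss of
      radius.\<close>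
    let ?a1 = "pi1_action r d0 x0 c' a0"
    have a1: "?a1 \<in> homotopy_set d0 x0"
      using pi1_action_in_homotopy_set[OF c' a0] .
    have "hdist ?a1 a < e"
      using hdist_pi1_action[OF c a1 a] less by (simp add: inv a0)
    let ?U = "{k \<in> homotopy_set 1 x0. hdist c k < e} \<times> {b \<in> homotopy_set d0 x0. hdist ?a1 b < e}"
    have "openin ?T ?U"
      using openin_htop_ball[OF c \<open>e > 0\<close>] openin_htop_ball[OF a1 \<open>e > 0\<close>]
      by (simp add: openin_prod_Times_iff)
    moreover have "(c, a) \<in> ?U"
      using c a \<open>hdist ?a1 a < e\<close> hdist_self_less[OF one c \<open>e > 0\<close>] by simp
    moreover have "?U \<subseteq> ?f -` {b \<in> homotopy_set d0 x0. hdist a0 b < e} \<inter> topspace ?T"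
    proof clarify
      fix k b
      assume k: "k \<in> homotopy_set 1 x0" "hdist c k < e"
        and b: "b \<in> homotopy_set d0 x0" "hdist ?a1 b < e"
      then show "(k, b) \<in> ?f -` {b \<in> homotopy_set d0 x0. hdist a0 b < e} \<inter> topspace ?T"
        using hdist_pi1_action_less[OF c k(1) a1 b(1) k(2) b(2)] pi1_action_in_homotopy_set[OF k(1) b(1)]
        unfolding top by (simp add: inv a0)
    qed
    ultimately show "\<exists>U. openin ?T U \<and> (c, a) \<in> U \<and>
        U \<subseteq> ?f -` {b \<in> homotopy_set d0 x0. hdist a0 b < e} \<inter> topspace ?T"
      by blast
  qed
  moreover have "?f ` topspace ?T \<subseteq> topspace (htop d0 x0)"
    unfolding top topspace_htop[OF base] using pi1_action_in_homotopy_set by auto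
  ultimately show ?thesis
    unfolding htop_def[of d0 x0] continuous_on_generated_topo_iff topology_generated_by_topspace
    by auto
qed

end

theorem theorem4p12:
  fixes x0 :: "'a::metric_space" and d0 :: "'b::euclidean_space"
    and r :: "'b \<times> real \<Rightarrow> 'b \<times> real"
  assumes "path_connected (UNIV :: 'a set)"
    and "DIM('b) \<ge> 2"
    and "d0 \<in> Basis"
    and "retraction (sphere 0 1 \<times> {0..1}) (sphere 0 1 \<times> {0} \<union> {d0} \<times> {0..1}) r"
  shows "continuous_map (prod_topology (htop (1::complex) x0) (htop d0 x0)) (htop d0 x0)
           (\<lambda>(c, a). pi1_action r d0 x0 c a) \<and>
         (\<forall>c \<in> homotopy_set (1::complex) x0. \<forall>a \<in> homotopy_set d0 x0. \<forall>b \<in> homotopy_set d0 x0.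
           hdist (pi1_action r d0 x0 c a) (pi1_action r d0 x0 c b) = hdist a b)"
proof -
  \<comment> \<open>A basis vector has norm 1, so \<open>d0\<close> lies on the unit sphere.\<close>
  interpret cylinder_retraction d0 r
    using assms by unfold_locales simp_all
  show ?thesis
    using continuous_map_pi1_action hdist_pi1_action by blast
qed

end
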